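(* Let $\mathbb{X}, \mathbb{Y}, \mathbb{Z}$ be real Banach spaces, each of dimension strictly greater than $1$, and let $\mathcal{T} \in \mathscr{B}(\mathbb{X} \times \mathbb{Y}, \mathbb{Z})$. Let $(x_0,y_0) \in S_{\mathbb{X} \times \mathbb{Y}}$. Then $(x_0,y_0) \in M_{\mathcal{T}}$ if and only if the following two conditions hold: (i) $\|x_0\| = \|y_0\| = 1$; (ii) there exist semi-inner-products $[\,\cdot,\cdot\,]_{\mathbb{X}}$ on $\mathbb{X}$, $[\,\cdot,\cdot\,]_{\mathbb{Y}}$ on $\mathbb{Y}$, and semi-inner-products $[\,\cdot,\cdot\,]_1$, $[\,\cdot,\cdot\,]_2$ on $\mathbb{Z}$ (each compatible with the norm of the respective space) such that for every $x \in \mathbb{X}$ and every $y \in \mathbb{Y}$, \[ [\mathcal{T}(x_0,y), \mathcal{T}(x_0,y_0)]_{1} + [\mathcal{T}(x,y_0), \mathcal{T}(x_0,y_0)]_{2} = \|\mathcal{T}\|^{2} \big([x,x_0]_{\mathbb{X}} + [y,y_0]_{\mathbb{Y}}\big). \]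
   Context: The product $\mathbb{X} \times \mathbb{Y}$ carries the norm $\|(x,y)\| = \max\{\|x\|,\|y\|\}$, and $S_{\mathbb{X} \times \mathbb{Y}}$ is its unit sphere. For a bilinear operator $\mathcal{T}: \mathbb{X} \times \mathbb{Y} \to \mathbb{Z}$ (linear in each argument), $\|\mathcal{T}\| = \sup\{\|\mathcal{T}(x,y)\| : (x,y) \in S_{\mathbb{X} \times \mathbb{Y}}\}$; $\mathcal{T}$ is bounded if $\|\mathcal{T}\|<\infty$. $\mathscr{B}(\mathbb{X} \times \mathbb{Y}, \mathbb{Z})$ is the Banach space of all bounded bilinear operators from $\mathbb{X} \times \mathbb{Y}$ to $\mathbb{Z}$ with this norm. The norm attainment set is $M_{\mathcal{T}} = \{(x,y) \in S_{\mathbb{X} \times \mathbb{Y}} : \|\mathcal{T}(x,y)\| = \|\mathcal{T}\|\}$. A semi-inner-product (s.i.p.) on a real normed space $E$ is a function $[\,\cdot,\cdot\,]: E \times E \to \mathbb{R}$ such that for all $\alpha,\beta \in \mathbb{R}$ and $x,y,z \in E$: (a) $[\alpha x + \beta y, z] = \alpha[x,z] + \beta[y,z]$; (b) $[x,x] > 0$ whenever $x \neq 0$; (c) $|[x,y]|^2 \leq [x,x][y,y]$; (d) $[x,\alpha y] = \alpha[x,y]$. It is compatible with the norm if $[x,x] = \|x\|^2$ for all $x \in E$; every s.i.p. is assumed compatible with the norm.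
   Formalization: The operator T is additionally assumed to be nonzero; for T = 0 the claim fails, since then M_T is the whole unit sphere and contains points (0, y0) with ‖y0‖ = 1, which violate condition (i). *)

theory Defs
  imports "HOL-Analysis.Analysis"
begin

(* Spaces are types of class banach.  The library constant dim is 0 on
   infinite-dimensional spaces, so "dimension > 1" is stated through a Hamel basis. *)
definition dim_gt_one :: "'a::real_vector itself \<Rightarrow> bool" where
  "dim_gt_one _ \<longleftrightarrow>
     (\<exists>B::'a set. independent B \<and> span B = UNIV \<and> (infinite B \<or> card B > 1))"

(* The library norm on product types is the Euclidean one; here the maximum norm is needed. *)
definition max_norm :: "'a::real_normed_vector \<times> 'b::real_normed_vector \<Rightarrow> real" where
  "max_norm p = max (norm (fst p)) (norm (snd p))"

definition prod_sphere :: "('a::real_normed_vector \<times> 'b::real_normed_vector) set" where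
  "prod_sphere = {p. max_norm p = 1}"

(* Bilinear operators are curried. The supremum is meant for a bounded T on spaces
   that are not both zero; otherwise Sup on reals is unspecified. *)
definition bilin_norm ::
  "('a::real_normed_vector \<Rightarrow> 'b::real_normed_vector \<Rightarrow> 'c::real_normed_vector) \<Rightarrow> real" where
  "bilin_norm T = (SUP (x, y) \<in> prod_sphere. norm (T x y))"

definition norm_attainment_set ::
  "('a::real_normed_vector \<Rightarrow> 'b::real_normed_vector \<Rightarrow> 'c::real_normed_vector) \<Rightarrow> ('a \<times> 'b) set" where
  "norm_attainment_set T = {(x, y) \<in> prod_sphere. norm (T x y) = bilin_norm T}"

definition semi_inner_product :: "('a::real_normed_vector \<Rightarrow> 'a \<Rightarrow> real) \<Rightarrow> bool" where
  "semi_inner_product s \<longleftrightarrow>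
     (\<forall>\<alpha> \<beta> x y z. s (\<alpha> *\<^sub>R x + \<beta> *\<^sub>R y) z = \<alpha> * s x z + \<beta> * s y z) \<and>
     (\<forall>x. x \<noteq> 0 \<longrightarrow> s x x > 0) \<and>
     (\<forall>x y. \<bar>s x y\<bar>\<^sup>2 \<le> s x x * s y y) \<and>
     (\<forall>\<alpha> x y. s x (\<alpha> *\<^sub>R y) = \<alpha> * s x y)"

definition norm_compatible :: "('a::real_normed_vector \<Rightarrow> 'a \<Rightarrow> real) \<Rightarrow> bool" where
  "norm_compatible s \<longleftrightarrow> (\<forall>x. s x x = (norm x)\<^sup>2)"

(* Finiteness of the supremum defining bilin_norm is the library's boundedness. *)
lemma bounded_bilinear_iff_bdd_above:
  fixes T :: "'a::real_normed_vector \<Rightarrow> 'b::real_normed_vector \<Rightarrow> 'c::real_normed_vector"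
  shows "bounded_bilinear T \<longleftrightarrow>
    (\<forall>x. linear (T x)) \<and> (\<forall>y. linear (\<lambda>x. T x y)) \<and>
    bdd_above ((\<lambda>(x, y). norm (T x y)) ` prod_sphere)" (is "?L \<longleftrightarrow> ?R")
proof
  assume ?L
  then interpret bounded_bilinear T .
  obtain K where K: "0 \<le> K" "\<And>a b. norm (T a b) \<le> norm a * norm b * K"
    using nonneg_bounded by blast
  have "norm (T a b) \<le> K" if "(a, b) \<in> prod_sphere" for a b
  proof -
    have "norm a \<le> 1" "norm b \<le> 1"
      using that by (auto simp: prod_sphere_def max_norm_def)
    then have "norm a * norm b * K \<le> 1 * K"
      by (intro mult_right_mono mult_le_one) (use K in auto)
    then show ?thesis using K(2)[of a b] by simp
  qed
  then have "bdd_above ((\<lambda>(x, y). norm (T x y)) ` prod_sphere)"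
    by (auto intro!: bdd_aboveI)
  then show ?R
    using bounded_linear.linear[OF bounded_linear_left]
      bounded_linear.linear[OF bounded_linear_right] by auto
next
  assume R: ?R
  then obtain K where K: "\<And>a b. (a, b) \<in> prod_sphere \<Longrightarrow> norm (T a b) \<le> K"
    unfolding bdd_above_def by fastforce
  have l1: "linear (T x)" and l2: "linear (\<lambda>x. T x y)" for x y
    using R by auto
  note lin = linear_add[OF l1] linear_add[OF l2] linear_scale[OF l1] linear_scale[OF l2]
    linear_0[OF l1] linear_0[OF l2]
  have "norm (T a b) \<le> norm a * norm b * K" for a b
  proof (cases "a = 0 \<or> b = 0")
    case True
    then show ?thesis by (auto simp: lin)
  next
    case False
    have "((1 / norm a) *\<^sub>R a, (1 / norm b) *\<^sub>R b) \<in> prod_sphere"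
      using False by (simp add: prod_sphere_def max_norm_def)
    from K[OF this] show ?thesis
      using False by (simp add: lin field_simps)
  qed
  then show ?L
    by unfold_locales (auto simp: lin)
qed

end

theory Submission
  imports Defs
begin

text \<open>
  If \<open>T\<close> attains its norm \<open>N\<close> at \<open>(x0, y0)\<close>, homogeneity forces \<open>norm x0 = norm y0 = 1\<close>.
  A support functional \<open>f\<close> at \<open>w = T x0 y0\<close> (Hahn--Banach) then pulls back to support functionals
  \<open>x \<mapsto> f (T x y0) / N\<^sup>2\<close> at \<open>x0\<close> and \<open>y \<mapsto> f (T x0 y) / N\<^sup>2\<close> at \<open>y0\<close>, and any
  support functional at one point extends to a semi-inner-product by choosing
  one on each remaining line.  Conversely, evaluating the identity at \<open>(x0, 0)\<close> gives
  \<open>(norm w)\<^sup>2 = N\<^sup>2\<close>.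
\<close>

section \<open>Sublinear functionals and the Hahn-Banach theorem\<close>

text \<open>The scaling law is an inequality for \<open>t > 0\<close> because this form passes
  directly to infima; equality for \<open>t \<ge> 0\<close> follows by scaling back with
  \<open>1/t\<close>.\<close>

definition sublinear :: "('a::real_vector \<Rightarrow> real) \<Rightarrow> bool" where
  "sublinear p \<longleftrightarrow> (\<forall>x y. p (x + y) \<le> p x + p y) \<and> (\<forall>t>0. \<forall>x. p (t *\<^sub>R x) \<le> t * p x)"

lemma sublinear_add: "sublinear p \<Longrightarrow> p (x + y) \<le> p x + p y"
  by (simp add: sublinear_def)

lemma sublinear_zero: assumes "sublinear p" shows "p 0 = 0"
proof -
  have "p 0 \<le> p 0 + p 0" "p ((1/2) *\<^sub>R 0) \<le> 1/2 * p 0"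
    using assms sublinear_add[of p 0 0] unfolding sublinear_def by (simp, metis half_gt_zero_iff zero_less_one)
  then show ?thesis by simp
qed

lemma sublinear_scale:
  assumes p: "sublinear p" and t: "t \<ge> 0"
  shows "p (t *\<^sub>R x) = t * p x"
proof (cases "t = 0")
  case True
  then show ?thesis using sublinear_zero[OF p] by simp
next
  case False
  with t have t: "t > 0" by simp
  have "p ((1/t) *\<^sub>R (t *\<^sub>R x)) \<le> (1/t) * p (t *\<^sub>R x)"
    using p t unfolding sublinear_def by (meson zero_less_divide_1_iff)
  then have "t * p x \<le> p (t *\<^sub>R x)" using t by (simp add: field_simps)
  moreover have "p (t *\<^sub>R x) \<le> t * p x" using p t by (simp add: sublinear_def)
  ultimately show ?thesis by simp
qed

lemma sublinear_lower: assumes "sublinear p" shows "- p (- x) \<le> p x"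
  using sublinear_add[OF assms, of x "- x"] sublinear_zero[OF assms] by simp

text \<open>The single \<open>F i\<close> may fail to be sublinear: each sum or multiple only has to
  be matched by some index \<open>k\<close>, and the infima on the right are then taken one index at
  a time. This covers infima along a ray as well as infima of chains.\<close>

lemma sublinear_INF:
  fixes F :: "'i \<Rightarrow> 'a::real_vector \<Rightarrow> real"
  assumes ne: "I \<noteq> {}"
    and bdd: "\<And>x. bdd_below ((\<lambda>i. F i x) ` I)"
    and add: "\<And>i j x y. i \<in> I \<Longrightarrow> j \<in> I \<Longrightarrow> \<exists>k\<in>I. F k (x + y) \<le> F i x + F j y"
    and scale: "\<And>i t x. i \<in> I \<Longrightarrow> t > 0 \<Longrightarrow> \<exists>k\<in>I. F k (t *\<^sub>R x) \<le> t * F i x"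
  shows "sublinear (\<lambda>x. INF i\<in>I. F i x)" (is "sublinear ?g")
proof -
  have low: "?g x \<le> F i x" if "i \<in> I" for i x
    by (rule cINF_lower[OF bdd that])
  have "?g (x + y) \<le> ?g x + ?g y" for x y
  proof -
    have *: "?g (x + y) \<le> F i x + F j y" if "i \<in> I" "j \<in> I" for i j
      using add[OF that] low by (meson order_trans)
    have "?g (x + y) - F i x \<le> ?g y" if "i \<in> I" for i
      by (rule cINF_greatest[OF ne]) (use *[OF that] in \<open>simp add: algebra_simps\<close>)
    then have "?g (x + y) - ?g y \<le> ?g x"
      by (intro cINF_greatest[OF ne]) (simp add: algebra_simps)
    then show ?thesis by simp
  qed
  moreover have "?g (t *\<^sub>R x) \<le> t * ?g x" if t: "t > 0" for t x
  proof -
    have "?g (t *\<^sub>R x) / t \<le> F i x" if i: "i \<in> I" for i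
    proof -
      have "?g (t *\<^sub>R x) \<le> t * F i x"
        using scale[OF i t] low by (meson order_trans)
      then show ?thesis using t by (simp add: field_simps)
    qed
    then have "?g (t *\<^sub>R x) / t \<le> ?g x"
      by (intro cINF_greatest[OF ne])
    then show ?thesis using t by (simp add: field_simps)
  qed
  ultimately show ?thesis by (simp add: sublinear_def)
qed

text \<open>The witness is the infimum over \<open>t \<ge> 0\<close> of
  \<open>p (x + t *\<^sub>R v) - t * p v\<close>; \<open>t = 0\<close> and \<open>t = 1\<close> give
  the two bounds. If \<open>p\<close> is minimal, then \<open>p' = p\<close> and the last bound is
  superadditivity; at \<open>x = - v\<close> it forces \<open>p' (- v) \<le> - p v\<close>.\<close>

lemma sublinear_reduce:
  assumes p: "sublinear p"
  obtains p' where "sublinear p'" "p' \<le> p" "\<And>x. p' x \<le> p (x + v) - p v"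
proof -
  define F where "F t x = p (x + t *\<^sub>R v) - t * p v" for t x
  have bdd: "bdd_below ((\<lambda>t. F t x) ` {0..})" for x
  proof (rule bdd_belowI2)
    fix t :: real assume "t \<in> {0..}"
    \<comment> \<open>Subadditivity for \<open>t *\<^sub>R v = (x + t *\<^sub>R v) + (- x)\<close>
      gives a bound independent of \<open>t\<close>.\<close>
    then show "- p (- x) \<le> F t x"
      using sublinear_add[OF p, of "x + t *\<^sub>R v" "- x"] sublinear_scale[OF p, of t v]
      by (simp add: F_def)
  qed
  have "sublinear (\<lambda>x. INF t\<in>{0..}. F t x)"
  proof (rule sublinear_INF[OF _ bdd])
    fix i j :: real and x y assume ij: "i \<in> {0..}" "j \<in> {0..}"
    have "F (i + j) (x + y) \<le> F i x + F j y"
      using sublinear_add[OF p, of "x + i *\<^sub>R v" "y + j *\<^sub>R v"]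
      by (simp add: F_def algebra_simps)
    then show "\<exists>k\<in>{0..}. F k (x + y) \<le> F i x + F j y"
      using ij by (intro bexI[of _ "i + j"]) auto
  next
    fix i t :: real and x assume it: "i \<in> {0..}" "t > 0"
    have "F (t * i) (t *\<^sub>R x) = t * F i x"
      using sublinear_scale[OF p, of t "x + i *\<^sub>R v"] it
      by (simp add: F_def algebra_simps)
    then show "\<exists>k\<in>{0..}. F k (t *\<^sub>R x) \<le> t * F i x"
      using it by (intro bexI[of _ "t * i"]) auto
  qed simp
  moreover have "(INF t\<in>{0..}. F t x) \<le> F s x" if "s \<ge> 0" for s x
    using that by (intro cINF_lower[OF bdd]) simp
  from this[of 0] this[of 1] have "(\<lambda>x. INF t\<in>{0..}. F t x) \<le> p"
    "\<And>x. (INF t\<in>{0..}. F t x) \<le> p (x + v) - p v"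
    by (auto simp: F_def le_fun_def)
  ultimately show ?thesis using that by blast
qed

text \<open>Hahn--Banach: a minimal sublinear functional is fixed by every reduction of
  \<open>sublinear_reduce\<close>, hence additive.\<close>

lemma linear_below_sublinear:
  fixes q :: "'a::real_vector \<Rightarrow> real"
  assumes q: "sublinear q"
  obtains f where "linear f" "f \<le> q"
proof -
  define A where "A = {p. sublinear p \<and> p \<le> q}"
  \<comment> \<open>The order is reversed, so the maximal element from Zorn's lemma is a minimal
    functional.\<close>
  have po: "partial_order_on A (relation_of (\<lambda>a b. b \<le> a) A)"
    by (rule partial_order_on_relation_ofI) auto
  have "\<exists>u\<in>A. \<forall>a\<in>C. u \<le> a" if C: "C \<in> Chains (relation_of (\<lambda>a b. b \<le> a) A)" for C
  proof (cases "C = {}")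
    case True
    then show ?thesis using q by (auto simp: A_def)
  next
    case False
    have CA: "p \<in> A" if "p \<in> C" for p
      using C that by (auto simp: Chains_def relation_of_def)
    have chain: "a \<le> b \<or> b \<le> a" if "a \<in> C" "b \<in> C" for a b
      using C that by (auto simp: Chains_def relation_of_def)
    let ?g = "\<lambda>x. INF p\<in>C. p x"
    have bdd: "bdd_below ((\<lambda>p. p x) ` C)" for x
    proof (rule bdd_belowI2)
      fix p assume "p \<in> C"
      then have "sublinear p" "p (- x) \<le> q (- x)"
        using CA by (auto simp: A_def le_fun_def)
      then show "- q (- x) \<le> p x" using sublinear_lower[of p x] by simp
    qed
    have low: "?g \<le> p" if "p \<in> C" for p
      unfolding le_fun_def using cINF_lower[OF bdd that] by simp
    have "sublinear ?g"
    proof (rule sublinear_INF[OF False bdd])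
      fix a b x y assume ab: "a \<in> C" "b \<in> C"
      \<comment> \<open>The smaller of \<open>a\<close> and \<open>b\<close> serves as
        \<open>k\<close>.\<close>
      then obtain k where k: "k \<in> C" "k \<le> a" "k \<le> b"
        using chain by blast
      have "k (x + y) \<le> k x + k y"
        using CA[OF k(1)] by (auto simp: A_def sublinear_add)
      also have "\<dots> \<le> a x + b y"
        using k by (auto simp: le_fun_def intro: add_mono)
      finally show "\<exists>k\<in>C. k (x + y) \<le> a x + b y" using k(1) by blast
    next
      fix a x and t :: real assume "a \<in> C" "t > 0"
      then show "\<exists>k\<in>C. k (t *\<^sub>R x) \<le> t * a x"
        using CA by (auto simp: A_def sublinear_def)
    qed
    moreover obtain p where "p \<in> C" using False by blast
    then have "?g \<le> q" using low[of p] CA[of p] by (auto simp: A_def intro: order_trans)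
    ultimately have "?g \<in> A" by (simp add: A_def)
    then show ?thesis using low by blast
  qed
  then obtain f where f: "f \<in> A" and min: "\<And>p. p \<in> A \<Longrightarrow> p \<le> f \<Longrightarrow> p = f"
    using predicate_Zorn[OF po] by blast
  have sub: "sublinear f" and fq: "f \<le> q" using f by (auto simp: A_def)
  have add: "f (x + v) = f x + f v" for x v
  proof -
    obtain p where p: "sublinear p" "p \<le> f" "\<And>x. p x \<le> f (x + v) - f v"
      using sublinear_reduce[OF sub, of v] by blast
    then have "p = f" using fq by (intro min) (auto simp: A_def intro: order_trans)
    then have "f x + f v \<le> f (x + v)" using p(3)[of x] by simp
    then show ?thesis using sublinear_add[OF sub, of x v] by simp
  qed
  have neg: "f (- x) = - f x" for x
    using add[of x "- x"] sublinear_zero[OF sub] by simp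
  have "f (t *\<^sub>R x) = t * f x" for t x
  proof (cases "t \<ge> 0")
    case True
    then show ?thesis by (rule sublinear_scale[OF sub])
  next
    case False
    then show ?thesis using sublinear_scale[OF sub, of "- t" x] neg[of "t *\<^sub>R x"] by simp
  qed
  with add have "linear f" by (intro linearI) auto
  with fq that show ?thesis by blast
qed

section \<open>Support functionals and semi-inner-products\<close>

text \<open>Scaled by \<open>norm u\<close>, so that it has exactly the shape of
  \<open>x \<mapsto> s x u\<close> for a compatible semi-inner-product \<open>s\<close>.\<close>

definition support_functional :: "'a::real_normed_vector \<Rightarrow> ('a \<Rightarrow> real) \<Rightarrow> bool" where
  "support_functional u f \<longleftrightarrow>
     linear f \<and> f u = (norm u)\<^sup>2 \<and> (\<forall>x. \<bar>f x\<bar> \<le> norm u * norm x)"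

text \<open>Reducing the norm along \<open>u\<close> first replaces an extension from the line of
  \<open>u\<close>: every linear \<open>f\<close> below the reduced \<open>p\<close> satisfies
  \<open>f (- u) \<le> - norm u\<close>, hence \<open>f u = norm u\<close>.\<close>

lemma support_functional_exists: "\<exists>f. support_functional u f"
proof -
  have "sublinear (norm :: 'a \<Rightarrow> real)"
    by (auto simp: sublinear_def norm_triangle_ineq)
  then obtain p where p: "sublinear p" "p \<le> norm" "\<And>x. p x \<le> norm (x + u) - norm u"
    using sublinear_reduce[where v = u] by blast
  obtain f where f: "linear f" "f \<le> p"
    using linear_below_sublinear[OF p(1)] by blast
  interpret linear f by fact
  have le: "f x \<le> norm x" for x
    using f(2) p(2) by (meson le_funD order_trans)
  have abs: "\<bar>f x\<bar> \<le> norm x" for x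
    using le[of x] le[of "- x"] by (simp add: neg abs_le_iff)
  have "f (- u) \<le> - norm u"
    using le_funD[OF f(2), of "- u"] p(3)[of "- u"] by simp
  then have "f u = norm u" using le[of u] by (simp add: neg)
  then have "support_functional u (\<lambda>x. norm u * f x)"
    using abs by (auto simp: support_functional_def power2_eq_square abs_mult add scale
        mult.left_commute distrib_left intro!: linearI mult_left_mono)
  then show ?thesis by blast
qed

text \<open>Given the bound by norms, only homogeneity ties different second arguments together, so
  a support functional can be chosen freely at one point of each line, in particular
  \<open>f\<close> at \<open>u\<close>.\<close>

lemma semi_inner_product_extends_support_functional:
  fixes u :: "'a::real_normed_vector"
  assumes f: "support_functional u f" and u: "u \<noteq> 0"
  obtains s where "semi_inner_product s" "norm_compatible s" "\<And>x. s x u = f x"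
proof -
  \<comment> \<open>A representative of the punctured line through \<open>y\<close>, equal to \<open>u\<close> on the line of \<open>u\<close>;
    since it depends on the line only, the resulting product is homogeneous in its
    second argument.\<close>
  define line where "line y = {c *\<^sub>R y | c. c \<noteq> 0}" for y :: 'a
  define r where "r y = (if u \<in> line y then u else SOME z. z \<in> line y)" for y
  \<comment> \<open>The coordinate of \<open>y\<close> relative to its representative.\<close>
  define c where "c y = (SOME c. y = c *\<^sub>R r y)" for y
  define F where "F z = (if z = u then f else SOME g. support_functional z g)" for z
  define s where "s x y = c y * F (r y) x" for x y
  have F: "support_functional z (F z)" for z
    using f someI_ex[OF support_functional_exists[of z]] by (simp add: F_def)
  have "y \<in> line y" for y by (auto simp: line_def intro!: exI[of _ 1])
  then have "r y \<in> line y" for y using someI[of "\<lambda>z. z \<in> line y" y] by (simp add: r_def)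
  then obtain b where b: "\<And>y. b y \<noteq> 0" "\<And>y. r y = b y *\<^sub>R y"
    unfolding line_def by (simp, metis)
  have "\<exists>c. y = c *\<^sub>R r y" for y
    by (rule exI[of _ "1 / b y"]) (simp add: b)
  then have c: "y = c y *\<^sub>R r y" for y unfolding c_def by (rule someI_ex)
  have r0: "r y = 0 \<longleftrightarrow> y = 0" for y by (simp add: b)
  have lin: "linear (F z)" for z using F by (simp add: support_functional_def)
  have bound: "\<bar>F z x\<bar> \<le> norm z * norm x" for z x using F by (simp add: support_functional_def)
  \<comment> \<open>This settles \<open>y = 0\<close>, where \<open>c 0\<close> is arbitrary but
    \<open>r 0 = 0\<close>.\<close>
  have F0: "F 0 x = 0" for x using bound[of 0 x] by simp
  have diag: "s y y = (norm y)\<^sup>2" for y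
  proof -
    have "s y y = c y * F (r y) (c y *\<^sub>R r y)" using c[of y] by (simp add: s_def)
    also have "\<dots> = (c y)\<^sup>2 * (norm (r y))\<^sup>2"
      using F[of "r y"] by (simp add: linear_scale[OF lin] support_functional_def power2_eq_square)
    also have "\<dots> = (norm (c y *\<^sub>R r y))\<^sup>2" by (simp add: power_mult_distrib)
    finally show ?thesis using c[of y] by simp
  qed
  have "\<bar>s x y\<bar> \<le> norm x * norm y" for x y
  proof -
    have "\<bar>s x y\<bar> \<le> \<bar>c y\<bar> * (norm (r y) * norm x)"
      by (simp add: s_def abs_mult bound mult_left_mono)
    also have "\<dots> = norm x * norm (c y *\<^sub>R r y)" by simp
    finally show ?thesis using c[of y] by simp
  qed
  then have cs: "\<bar>s x y\<bar>\<^sup>2 \<le> s x x * s y y" for x y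
    using power_mono[of "\<bar>s x y\<bar>" "norm x * norm y" 2] by (simp add: diag power_mult_distrib)
  have hom: "s x (a *\<^sub>R y) = a * s x y" for a x y
  proof (cases "a = 0 \<or> y = 0")
    case True
    then have "s x (a *\<^sub>R y) = 0" "a * s x y = 0"
      using r0[of "a *\<^sub>R y"] r0[of y] by (auto simp: s_def F0)
    then show ?thesis by simp
  next
    case False
    have "line (a *\<^sub>R y) = line y"
    proof (intro set_eqI iffI)
      fix z assume "z \<in> line (a *\<^sub>R y)"
      then show "z \<in> line y" using False unfolding line_def by auto
    next
      fix z assume "z \<in> line y"
      then obtain d where "d \<noteq> 0" "z = d *\<^sub>R y" unfolding line_def by blast
      then show "z \<in> line (a *\<^sub>R y)"
        using False unfolding line_def by (auto intro!: exI[of _ "d / a"])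
    qed
    then have ra: "r (a *\<^sub>R y) = r y" by (simp add: r_def)
    have "c (a *\<^sub>R y) *\<^sub>R r y = a *\<^sub>R y" using c[of "a *\<^sub>R y"] ra by simp
    also have "\<dots> = (a * c y) *\<^sub>R r y" using arg_cong[OF c[of y], of "scaleR a"] by simp
    \<comment> \<open>Coordinates are unique because \<open>r y \<noteq> 0\<close>.\<close>
    finally have "c (a *\<^sub>R y) = a * c y" using False r0[of y] by simp
    then show ?thesis by (simp add: s_def ra)
  qed
  have "semi_inner_product s"
    unfolding semi_inner_product_def
    using cs hom by (auto simp: diag)
      (simp add: s_def linear_add[OF lin] linear_scale[OF lin] algebra_simps)
  moreover have "norm_compatible s" by (simp add: norm_compatible_def diag)
  moreover have "s x u = f x" for x
  proof -
    have ru: "r u = u" using \<open>\<And>y. y \<in> line y\<close> by (simp add: r_def)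
    with c[of u] u have "c u = 1" by (metis scaleR_one scaleR_cancel_right)
    then show ?thesis by (simp add: s_def ru F_def)
  qed
  ultimately show ?thesis using that by blast
qed

section \<open>Norm attainment of bilinear operators\<close>

text \<open>For nonzero \<open>a\<close> and \<open>b\<close>, normalising each separately gives a
  pair on the max-norm sphere.\<close>

lemma norm_le_bilin_norm:
  assumes "bounded_bilinear T"
  shows "norm (T a b) \<le> bilin_norm T * norm a * norm b"
proof -
  interpret bounded_bilinear T by fact
  have bdd: "bdd_above ((\<lambda>(x, y). norm (T x y)) ` prod_sphere)"
    using assms by (simp add: bounded_bilinear_iff_bdd_above)
  show ?thesis
  proof (cases "a = 0 \<or> b = 0")
    case True
    then show ?thesis by (auto simp: zero_left zero_right)
  next
    case False
    have "((1 / norm a) *\<^sub>R a, (1 / norm b) *\<^sub>R b) \<in> prod_sphere"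
      using False by (simp add: prod_sphere_def max_norm_def)
    from cSUP_upper[OF this bdd]
    have "norm (T a b) / (norm a * norm b) \<le> bilin_norm T"
      by (simp add: bilin_norm_def scaleR_left scaleR_right divide_inverse mult_ac)
    then show ?thesis
      using False by (simp add: pos_divide_le_eq mult.assoc)
  qed
qed

theorem theorem2p6:
  fixes T :: "'x::banach \<Rightarrow> 'y::banach \<Rightarrow> 'z::banach"
    and x0 :: 'x and y0 :: 'y
  assumes "dim_gt_one TYPE('x)" and "dim_gt_one TYPE('y)" and "dim_gt_one TYPE('z)"
    and "bounded_bilinear T"
    and nonzero: "T \<noteq> (\<lambda>x y. 0)"
    and "(x0, y0) \<in> prod_sphere"
  shows "(x0, y0) \<in> norm_attainment_set T \<longleftrightarrow>
    (norm x0 = 1 \<and> norm y0 = 1) \<and>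
    (\<exists>(sX :: 'x \<Rightarrow> 'x \<Rightarrow> real) (sY :: 'y \<Rightarrow> 'y \<Rightarrow> real)
       (s1 :: 'z \<Rightarrow> 'z \<Rightarrow> real) (s2 :: 'z \<Rightarrow> 'z \<Rightarrow> real).
       semi_inner_product sX \<and> norm_compatible sX \<and>
       semi_inner_product sY \<and> norm_compatible sY \<and>
       semi_inner_product s1 \<and> norm_compatible s1 \<and>
       semi_inner_product s2 \<and> norm_compatible s2 \<and>
       (\<forall>x y. s1 (T x0 y) (T x0 y0) + s2 (T x y0) (T x0 y0)
              = (bilin_norm T)\<^sup>2 * (sX x x0 + sY y y0)))"
proof (rule iffI, goal_cases)
  case 1
  interpret bounded_bilinear T by fact
  let ?N = "bilin_norm T" and ?w = "T x0 y0"
  note bound = norm_le_bilin_norm[OF \<open>bounded_bilinear T\<close>]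
  have le1: "norm x0 \<le> 1" "norm y0 \<le> 1"
    using assms(6) by (auto simp: prod_sphere_def max_norm_def)
  \<comment> \<open>A nonzero value makes \<open>?N\<close> positive, as the divisions below
    require. The zero operator attains its norm on the whole sphere, even where
    \<open>y0 = 0\<close>.\<close>
  obtain a b where "T a b \<noteq> 0" using nonzero by (metis ext)
  then have "0 < ?N * norm a * norm b" using bound[of a b]
    by (meson less_le_trans zero_less_norm_iff)
  then have N: "?N > 0"
    by (metis norm_ge_zero not_less mult_nonpos_nonneg)
  from 1 have w: "norm ?w = ?N" by (simp add: norm_attainment_set_def)
  \<comment> \<open>Attainment turns the general bound into
    \<open>1 \<le> norm x0 * norm y0\<close>, and neither factor exceeds 1.\<close>
  have "?N * 1 \<le> ?N * (norm x0 * norm y0)"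
    using bound[of x0 y0] w by (simp add: mult.assoc)
  then have "1 \<le> norm x0 * norm y0"
    using N by (simp only: mult_le_cancel_left_pos)
  moreover have "norm x0 * norm y0 \<le> norm x0" "norm x0 * norm y0 \<le> norm y0"
    using le1 mult_left_le[of "norm y0" "norm x0"] mult_left_le_one_le[of "norm y0" "norm x0"]
    by simp_all
  ultimately have n1: "norm x0 = 1" "norm y0 = 1" using le1 by linarith+
  then have "x0 \<noteq> 0" "y0 \<noteq> 0" by auto
  obtain f where f: "support_functional ?w f" using support_functional_exists by blast
  then have lin: "linear f" and fw: "f ?w = ?N\<^sup>2" and fb: "\<And>z. \<bar>f z\<bar> \<le> ?N * norm z"
    by (auto simp: support_functional_def w)
  have "?w \<noteq> 0" using w N by auto
  \<comment> \<open>This one product serves as both \<open>s1\<close> and \<open>s2\<close>.\<close>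
  then obtain s where s: "semi_inner_product s" "norm_compatible s" "\<And>z. s z ?w = f z"
    using semi_inner_product_extends_support_functional[OF f] by blast
  \<comment> \<open>Both \<open>f\<close> and \<open>x \<mapsto> T x y0\<close> contribute a factor
    \<open>?N\<close>, the latter as \<open>norm y0 = 1\<close>; the quotient takes the value 1 at
    \<open>x0\<close> since \<open>f ?w = ?N\<^sup>2\<close>.\<close>
  have "\<bar>f (T x y0) / ?N\<^sup>2\<bar> \<le> norm x" for x
  proof -
    have "\<bar>f (T x y0)\<bar> \<le> ?N * (?N * norm x)"
      using N n1 bound[of x y0]
      by (intro order_trans[OF fb] mult_left_mono) auto
    then show ?thesis using N by (simp add: field_simps power2_eq_square)
  qed
  then have "support_functional x0 (\<lambda>x. f (T x y0) / ?N\<^sup>2)"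
    using N n1 fw by (auto simp: support_functional_def add_left scaleR_left linear_add[OF lin]
        linear_scale[OF lin] add_divide_distrib intro!: linearI)
  from semi_inner_product_extends_support_functional[OF this \<open>x0 \<noteq> 0\<close>]
  obtain sX where sX: "semi_inner_product sX" "norm_compatible sX"
    "\<And>x. sX x x0 = f (T x y0) / ?N\<^sup>2" by blast
  have "\<bar>f (T x0 y) / ?N\<^sup>2\<bar> \<le> norm y" for y
  proof -
    have "\<bar>f (T x0 y)\<bar> \<le> ?N * (?N * norm y)"
      using N n1 bound[of x0 y]
      by (intro order_trans[OF fb] mult_left_mono) auto
    then show ?thesis using N by (simp add: field_simps power2_eq_square)
  qed
  then have "support_functional y0 (\<lambda>y. f (T x0 y) / ?N\<^sup>2)"
    using N n1 fw by (auto simp: support_functional_def add_right scaleR_right linear_add[OF lin]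
        linear_scale[OF lin] add_divide_distrib intro!: linearI)
  from semi_inner_product_extends_support_functional[OF this \<open>y0 \<noteq> 0\<close>]
  obtain sY where sY: "semi_inner_product sY" "norm_compatible sY"
    "\<And>y. sY y y0 = f (T x0 y) / ?N\<^sup>2" by blast
  have "s (T x0 y) ?w + s (T x y0) ?w = ?N\<^sup>2 * (sX x x0 + sY y y0)" for x y
    using N by (simp add: s(3) sX(3) sY(3) field_simps)
  with n1 s(1,2) sX(1,2) sY(1,2) show ?case by blast
next
  case 2
  interpret bounded_bilinear T by fact
  let ?N = "bilin_norm T" and ?w = "T x0 y0"
  from 2 obtain sX sY s1 s2 where n1: "norm x0 = 1" "norm y0 = 1"
    and c: "norm_compatible sX" "norm_compatible s2"
    and s: "semi_inner_product sY" "semi_inner_product s1"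
    and eq: "\<And>x y. s1 (T x0 y) ?w + s2 (T x y0) ?w = ?N\<^sup>2 * (sX x x0 + sY y y0)"
    by blast
  have z: "s1 0 z = 0" "sY 0 z' = 0" for z z'
    using s unfolding semi_inner_product_def by (metis add_0 mult_zero_left scale_zero_left)+
  \<comment> \<open>At \<open>y = 0\<close> the \<open>s1\<close> and \<open>sY\<close> terms
    vanish, leaving \<open>s2 ?w ?w = ?N\<^sup>2 * sX x0 x0\<close>, where
    \<open>sX x0 x0 = 1\<close>.\<close>
  have "(norm ?w)\<^sup>2 = ?N\<^sup>2"
    using eq[where x = x0 and y = 0] c n1 by (simp add: zero_right z norm_compatible_def)
  \<comment> \<open>The sign allows the squares to be removed; it comes from the bound at the unit
    vectors \<open>x0\<close>, \<open>y0\<close>.\<close>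
  moreover have "?N \<ge> 0"
    using order_trans[OF norm_ge_zero norm_le_bilin_norm[OF \<open>bounded_bilinear T\<close>, of x0 y0]] n1
    by simp
  ultimately have "norm ?w = ?N" by simp
  then show "(x0, y0) \<in> norm_attainment_set T"
    using assms(6) by (simp add: norm_attainment_set_def)
qed

end
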